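(* Let $t$ be a positive integer and let $G$ be a chordal graph with clique number at most $t$. Then $\chi(\mathit{AC}(G))\le\binom{t+1}{2}$.
   Context: All graphs are finite and simple. A graph is chordal if every induced cycle is a triangle. A clique of $G$ here means a nonempty set of pairwise adjacent vertices (equivalently the complete subgraph it induces; cliques need not be maximal). Two cliques $K$ and $K^*$ of $G$ are adjacent if they are disjoint and there exist $x\in K$, $y\in K^*$ with $xy\in E(G)$. The adjacent-cliques graph $\mathit{AC}(G)$ has one vertex for each clique of $G$, two vertices being adjacent if and only if their corresponding cliques are adjacent. $\chi$ denotes chromatic number. *)

theory Defs
  imports "Graph_Theory.Graph_Theory"
begin

text \<open>
  Following the library, a finite simple graph is a finite, loop-free, symmetric digraph
  without parallel arcs: the locale \<^locale>\<open>pair_graph\<close>. An edge \<open>xy\<close> is the pair of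
  arcs \<open>(x, y)\<close> and \<open>(y, x)\<close>.
\<close>

text \<open>
  The library's \<^const>\<open>pre_digraph.cycle\<close> is not used here: in a symmetric digraph it
  also admits the closed walks \<open>a, b, a\<close>.
\<close>

definition cycle_graph :: "'a pair_pre_digraph \<Rightarrow> bool" where
  "cycle_graph C \<longleftrightarrow> (\<exists>vs. 3 \<le> length vs \<and> distinct vs \<and> pverts C = set vs \<and>
     parcs C = (\<Union>i<length vs. {(vs ! i, vs ! (Suc i mod length vs)),
                              (vs ! (Suc i mod length vs), vs ! i)}))"

definition chordal :: "'a pair_pre_digraph \<Rightarrow> bool" where
  "chordal G \<longleftrightarrow> (\<forall>C :: 'a pair_pre_digraph.
     induced_subgraph (with_proj C) (with_proj G) \<and> cycle_graph C \<longrightarrow> card (pverts C) = 3)"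

definition cliques :: "'a pair_pre_digraph \<Rightarrow> 'a set set" where
  "cliques G = {K. K \<noteq> {} \<and> K \<subseteq> pverts G \<and> (\<forall>x\<in>K. \<forall>y\<in>K. x \<noteq> y \<longrightarrow> (x, y) \<in> parcs G)}"

text \<open>The \<open>0\<close> only matters for the graph without vertices, which has no cliques.\<close>

definition clique_number :: "'a pair_pre_digraph \<Rightarrow> nat" where
  "clique_number G = Max (insert 0 (card ` cliques G))"

definition adjacent_cliques :: "'a pair_pre_digraph \<Rightarrow> 'a set \<Rightarrow> 'a set \<Rightarrow> bool" where
  "adjacent_cliques G K L \<longleftrightarrow> K \<inter> L = {} \<and> (\<exists>x\<in>K. \<exists>y\<in>L. (x, y) \<in> parcs G)"

definition AC :: "'a pair_pre_digraph \<Rightarrow> 'a set pair_pre_digraph" where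
  "AC G = \<lparr> pverts = cliques G,
            parcs = {(K, L). K \<in> cliques G \<and> L \<in> cliques G \<and> adjacent_cliques G K L} \<rparr>"

definition proper_coloring :: "'a pair_pre_digraph \<Rightarrow> nat \<Rightarrow> ('a \<Rightarrow> nat) \<Rightarrow> bool" where
  "proper_coloring G k f \<longleftrightarrow>
     (\<forall>v\<in>pverts G. f v < k) \<and> (\<forall>(u, v)\<in>parcs G. f u \<noteq> f v)"

definition chromatic_number :: "'a pair_pre_digraph \<Rightarrow> nat" where
  "chromatic_number G = (LEAST k. \<exists>f. proper_coloring G k f)"

lemma finite_cliques:
  assumes "pair_graph G"
  shows "finite (cliques G)"
proof -
  interpret pair_graph G by fact
  have "cliques G \<subseteq> Pow (pverts G)"
    by (auto simp: cliques_def)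
  then show ?thesis
    using pair_finite_verts finite_subset by blast
qed

lemma pair_graph_AC:
  assumes "pair_graph G"
  shows "pair_graph (AC G)"
proof -
  interpret pair_graph G by fact
  have sym: "(y, x) \<in> parcs G" if "(x, y) \<in> parcs G" for x y
    using that pair_sym_arcs by (auto simp: symmetric_def dest: symD)
  show ?thesis
  proof
    show "finite (parcs (AC G))"
      by (rule finite_subset[of _ "cliques G \<times> cliques G"])
        (auto simp: AC_def finite_cliques[OF assms])
    show "symmetric (with_proj (AC G))"
      by (auto simp: symmetric_def sym_def AC_def adjacent_cliques_def dest: sym)
  qed (auto simp: AC_def finite_cliques[OF assms] adjacent_cliques_def cliques_def)
qed

lemma chromatic_number_attained:
  assumes "pair_graph G"
  shows "\<exists>f. proper_coloring G (chromatic_number G) f"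
proof -
  interpret pair_graph G by fact
  obtain f :: "'a \<Rightarrow> nat" and n where "f ` pverts G = {i. i < n}" "inj_on f (pverts G)"
    using finite_imp_inj_to_nat_seg[OF pair_finite_verts] by blast
  moreover have "f u \<noteq> f v" if "(u, v) \<in> parcs G" for u v
    using inj_onD[OF \<open>inj_on f (pverts G)\<close>] in_arcsD1[OF that] in_arcsD2[OF that]
      pair_no_loops[OF that] by auto
  ultimately have "proper_coloring G n f"
    unfolding proper_coloring_def by blast
  then show ?thesis
    unfolding chromatic_number_def by (intro LeastI[where P = "\<lambda>k. \<exists>f. proper_coloring G k f"] exI)
qed

end

theory Submission
  imports Defs
begin

text \<open>
  Order the vertices of \<open>G\<close> such that the earlier neighbours of every vertex form a clique, and
  represent a clique by its earliest vertex. If \<open>K\<close> and \<open>L\<close> are adjacent cliques, then, up to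
  exchanging them, the representative of \<open>K\<close> is reached from that of \<open>L\<close> by one or two
  steps to an earlier neighbour. As a vertex has at most \<open>t - 1\<close> earlier neighbours and these
  are pairwise adjacent, at most \<open>(t - 1) + (t - 1) + (t - 2) + \<dots> + 1\<close> vertices, one less than
  \<open>t + 1 choose 2\<close>, are reached in this way, so that the vertices, and with them the cliques,
  can be coloured greedily along the order.

  For the order it suffices to find a simplicial vertex. If the graph is not complete, take an
  inclusion-maximal connected set \<open>X\<close> that does not dominate the graph. The vertices \<open>W\<close> outside of
  the closed neighbourhood of \<open>X\<close> are joined completely to the neighbours of \<open>X\<close>, by maximality, and
  these are pairwise adjacent, since a shortest path through \<open>X\<close> between two nonadjacent ones
  would form an induced cycle with any vertex in \<open>W\<close>. Hence a simplicial vertex of \<open>W\<close> is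
  simplicial in the whole graph.
\<close>

subsection \<open>Simplicial vertices\<close>

definition cycle_arcs :: "'a list \<Rightarrow> 'a rel" where
  "cycle_arcs vs = (\<Union>i<length vs. {(vs ! i, vs ! (Suc i mod length vs)),
                              (vs ! (Suc i mod length vs), vs ! i)})"

text \<open>Chordality for a bare relation on a vertex set: no induced cycle has four or more
  vertices. In this form it passes to subsets at once, and the inductions need no subgraph
  records.\<close>

definition hole_free :: "'a rel \<Rightarrow> 'a set \<Rightarrow> bool" where
  "hole_free E V \<longleftrightarrow> (\<forall>vs. 4 \<le> length vs \<and> distinct vs \<and> set vs \<subseteq> V \<longrightarrow>
     E \<inter> set vs \<times> set vs \<noteq> cycle_arcs vs)"

definition clique_in :: "'a rel \<Rightarrow> 'a set \<Rightarrow> bool" where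
  "clique_in E K \<longleftrightarrow> (\<forall>x\<in>K. \<forall>y\<in>K. x \<noteq> y \<longrightarrow> (x, y) \<in> E)"

lemma hole_free_subset: "hole_free E V \<Longrightarrow> W \<subseteq> V \<Longrightarrow> hole_free E W"
  unfolding hole_free_def by blast

lemma chordal_hole_free:
  assumes "pair_graph G" "chordal G"
  shows "hole_free (parcs G) (pverts G)"
  unfolding hole_free_def
proof (intro allI impI notI, elim conjE)
  fix vs
  assume vs: "4 \<le> length vs" "distinct vs" "set vs \<subseteq> pverts G"
    and eq: "parcs G \<inter> set vs \<times> set vs = cycle_arcs vs"
  interpret pair_graph G by fact
  define C where "C = \<lparr>pverts = set vs, parcs = cycle_arcs vs\<rparr>"
  have "wf_digraph (with_proj C)"
    by unfold_locales (auto simp: C_def eq[symmetric])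
  moreover have "wf_digraph (with_proj G)"
    by unfold_locales
  ultimately have "induced_subgraph (with_proj C) (with_proj G)"
    using vs eq by (auto simp: induced_subgraph_def subgraph_def compatible_def C_def)
  moreover have "cycle_graph C"
    unfolding cycle_graph_def by (rule exI[of _ vs]) (use vs in \<open>auto simp: C_def cycle_arcs_def\<close>)
  ultimately have "card (pverts C) = 3"
    using \<open>chordal G\<close> unfolding chordal_def by blast
  with vs show False
    by (simp add: C_def distinct_card)
qed

text \<open>A walk with the fewest steps repeats no vertex and has no chord, as either would give a
  shortcut.\<close>

lemma shortest_path_induced:
  assumes "(s, s') \<in> (E \<inter> S \<times> S)\<^sup>*"
  obtains f :: "nat \<Rightarrow> 'a" and n where "f 0 = s" "f n = s'"
    "\<And>i. i < n \<Longrightarrow> (f i, f (Suc i)) \<in> E \<inter> S \<times> S"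
    "inj_on f {..n}" "\<And>i j. Suc i < j \<Longrightarrow> j \<le> n \<Longrightarrow> (f i, f j) \<notin> E"
proof -
  define R where "R = E \<inter> S \<times> S"
  define n where "n = (LEAST n. (s, s') \<in> R ^^ n)"
  have "\<exists>n. (s, s') \<in> R ^^ n"
    using assms rtrancl_imp_relpow unfolding R_def by blast
  then have "(s, s') \<in> R ^^ n"
    unfolding n_def by (rule LeastI_ex)
  then obtain f where f: "f 0 = s" "f n = s'" "\<And>i. i < n \<Longrightarrow> (f i, f (Suc i)) \<in> R"
    unfolding relpow_fun_conv by blast
  have min: "n \<le> m" if "(s, s') \<in> R ^^ m" for m
    using that unfolding n_def by (rule Least_le)
  have seg: "(f i, f j) \<in> R ^^ (j - i)" if "i \<le> j" "j \<le> n" for i j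
    unfolding relpow_fun_conv using that f(3) by (intro exI[of _ "\<lambda>k. f (i + k)"]) auto
  \<comment> \<open>Replacing the stretch from \<open>f i\<close> to \<open>f j\<close> by
    \<open>k\<close> steps cannot give a walk shorter than \<open>n\<close>. Taking
    \<open>k = 0\<close> excludes repetitions, \<open>k = 1\<close> excludes chords.\<close>
  have join: "n \<le> i + k + (n - j)" if "(f i, f j) \<in> R ^^ k" "i \<le> n" "j \<le> n" for i j k
  proof -
    have "(s, f i) \<in> R ^^ i" "(f j, s') \<in> R ^^ (n - j)"
      using seg[of 0 i] seg[of j n] that f by auto
    with that(1) have "(s, s') \<in> R ^^ (i + k + (n - j))"
      unfolding relpow_add by blast
    then show ?thesis by (rule min)
  qed
  have inj: "f i \<noteq> f j" if "i < j" "j \<le> n" for i j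
    using join[of i j 0] that by auto
  then have "inj_on f {..n}"
    by (metis atMost_iff inj_onI linorder_neqE_nat)
  moreover have "(f i, f j) \<notin> E" if "Suc i < j" "j \<le> n" for i j
  proof
    assume "(f i, f j) \<in> E"
    moreover have "f i \<in> S" "f j \<in> S"
      using f(3)[of i] f(3)[of "j - 1"] that by (auto simp: R_def)
    ultimately have "(f i, f j) \<in> R ^^ 1"
      by (simp add: R_def)
    from join[OF this] that show False by simp
  qed
  ultimately show ?thesis
    using that[of f n] f unfolding R_def by blast
qed

text \<open>As \<open>w\<close> sees only the two ends of the path, it closes the path to an induced
  cycle, which has \<open>n + 2 \<ge> 4\<close> vertices.\<close>

lemma induced_path_closes_to_hole:
  fixes f :: "nat \<Rightarrow> 'a"
  assumes "sym E" "irrefl E"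
    and "2 \<le> n" "inj_on f {..n}" "f ` {..n} \<subseteq> V" "w \<in> V" "w \<notin> f ` {..n}"
    and path: "\<And>i. i < n \<Longrightarrow> (f i, f (Suc i)) \<in> E"
    and induced: "\<And>i j. Suc i < j \<Longrightarrow> j \<le> n \<Longrightarrow> (f i, f j) \<notin> E"
    and w: "\<And>i. i \<le> n \<Longrightarrow> (f i, w) \<in> E \<longleftrightarrow> i = 0 \<or> i = n"
  shows "\<not> hole_free E V"
proof -
  \<comment> \<open>\<open>w\<close> takes index \<open>n + 1\<close>, so that the successor modulo
    \<open>n + 2\<close> leads from it back to \<open>f 0\<close>.\<close>
  define h where "h i = (if i \<le> n then f i else w)" for i
  define vs where "vs = map h [0..<n + 2]"
  have len: "length vs = n + 2"
    unfolding vs_def by simp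
  have nth: "vs ! i = h i" if "i < n + 2" for i
    using that unfolding vs_def by (simp del: upt_Suc)
  have set_vs: "set vs = h ` {..<n + 2}"
    unfolding vs_def by (simp add: atLeast0LessThan del: upt_Suc)
  have "inj_on h {..<n + 2}"
    using assms(4,7) unfolding h_def inj_on_def by (auto simp: less_Suc_eq_le le_Suc_eq)
  then have "distinct vs"
    unfolding vs_def by (simp add: distinct_map atLeast0LessThan del: upt_Suc)
  have "set vs \<subseteq> V"
    unfolding set_vs h_def using assms(5,6) by auto
  have succ: "Suc i mod (n + 2) = (if i = n + 1 then 0 else Suc i)" if "i < n + 2" for i
    using that by auto
  have lt: "(h i, h j) \<in> E \<longleftrightarrow> j = Suc i \<or> i = 0 \<and> j = n + 1" if "i < j" "j < n + 2" for i j
  proof (cases "j = n + 1")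
    case True
    then show ?thesis using w[of i] that by (auto simp: h_def)
  next
    case False
    then show ?thesis
      using path[of i] induced[of i j] that by (cases "j = Suc i") (auto simp: h_def)
  qed
  have adj: "(h i, h j) \<in> E \<longleftrightarrow> j = Suc i mod (n + 2) \<or> i = Suc j mod (n + 2)"
    if "i < n + 2" "j < n + 2" for i j
  proof (cases i j rule: linorder_cases)
    case less
    then show ?thesis using lt[OF less] that succ by auto
  next
    case equal
    then show ?thesis using \<open>irrefl E\<close> \<open>2 \<le> n\<close> that succ by (auto simp: irrefl_def)
  next
    case greater
    then show ?thesis using lt[OF greater] that succ symD[OF \<open>sym E\<close>] by auto
  qed
  have "E \<inter> set vs \<times> set vs = cycle_arcs vs"
  proof (intro set_eqI iffI)
    fix e assume "e \<in> E \<inter> set vs \<times> set vs"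
    then obtain i j where ij: "e = (h i, h j)" "i < n + 2" "j < n + 2" "e \<in> E"
      unfolding set_vs by auto
    then have "j = Suc i mod (n + 2) \<or> i = Suc j mod (n + 2)"
      using adj by blast
    then show "e \<in> cycle_arcs vs"
      unfolding cycle_arcs_def using ij by (auto simp: len nth)
  next
    fix e assume "e \<in> cycle_arcs vs"
    then obtain i where i: "i < n + 2" and
      "e = (h i, h (Suc i mod (n + 2))) \<or> e = (h (Suc i mod (n + 2)), h i)"
      unfolding cycle_arcs_def by (auto simp: len nth)
    moreover have "Suc i mod (n + 2) < n + 2"
      by simp
    ultimately show "e \<in> E \<inter> set vs \<times> set vs"
      unfolding set_vs using adj by blast
  qed
  moreover have "4 \<le> length vs"
    using \<open>2 \<le> n\<close> by (simp add: len)
  ultimately show ?thesis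
    unfolding hole_free_def using \<open>distinct vs\<close> \<open>set vs \<subseteq> V\<close> by blast
qed

lemma hole_free_common_neighbours_adjacent:
  assumes "hole_free E V" "sym E" "irrefl E"
    and "X \<subseteq> V" "s \<in> V" "s' \<in> V" "w \<in> V" "s \<noteq> s'"
    and conn: "\<And>x y. x \<in> X \<Longrightarrow> y \<in> X \<Longrightarrow> (x, y) \<in> (E \<inter> X \<times> X)\<^sup>*"
    and nb: "x \<in> X" "(s, x) \<in> E" "x' \<in> X" "(s', x') \<in> E"
    and w: "(s, w) \<in> E" "(s', w) \<in> E" "w \<notin> X" "\<And>x. x \<in> X \<Longrightarrow> (x, w) \<notin> E"
  shows "(s, s') \<in> E"
proof (rule ccontr)
  assume nonadj: "(s, s') \<notin> E"
  define S where "S = insert s (insert s' X)"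
  have "(x, x') \<in> (E \<inter> S \<times> S)\<^sup>*"
    using conn[OF nb(1,3)] rtrancl_mono[of "E \<inter> X \<times> X" "E \<inter> S \<times> S"] unfolding S_def by blast
  moreover have "(s, x) \<in> E \<inter> S \<times> S" "(x', s') \<in> E \<inter> S \<times> S"
    using nb symD[OF \<open>sym E\<close>] unfolding S_def by auto
  ultimately have "(s, s') \<in> (E \<inter> S \<times> S)\<^sup>*"
    by (meson converse_rtrancl_into_rtrancl rtrancl.rtrancl_into_rtrancl)
  then obtain f n where f: "f 0 = s" "f n = s'"
    "\<And>i. i < n \<Longrightarrow> (f i, f (Suc i)) \<in> E \<inter> S \<times> S"
    "inj_on f {..n}" "\<And>i j. Suc i < j \<Longrightarrow> j \<le> n \<Longrightarrow> (f i, f j) \<notin> E"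
    using shortest_path_induced[of s s' E S] by blast
  have "n \<noteq> 0" "n \<noteq> 1"
    using f(1,2) f(3)[of 0] \<open>s \<noteq> s'\<close> nonadj by (auto intro!: gr0I)
  then have "2 \<le> n" by simp
  have inS: "f i \<in> S" if "i \<le> n" for i
    using that f(1,2) f(3)[of i] by (cases "i = n") (auto simp: S_def)
  \<comment> \<open>Injectivity keeps the interior of the path off \<open>s\<close> and
    \<open>s'\<close>, hence inside \<open>X\<close>, where no vertex is adjacent to
    \<open>w\<close>.\<close>
  have inX: "f i \<in> X" if "0 < i" "i < n" for i
    using inS[of i] that f(1,2) inj_onD[OF f(4), of i 0] inj_onD[OF f(4), of i n]
    unfolding S_def by auto
  have fw: "(f i, w) \<in> E \<longleftrightarrow> i = 0 \<or> i = n" if "i \<le> n" for i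
    using w f(1,2) inX[of i] that by (cases "i = 0 \<or> i = n") auto
  have "w \<notin> S"
    using w \<open>irrefl E\<close> unfolding S_def irrefl_def by auto
  have "\<not> hole_free E V"
  proof (rule induced_path_closes_to_hole[OF assms(2,3) \<open>2 \<le> n\<close> f(4)])
    show "f ` {..n} \<subseteq> V" "w \<notin> f ` {..n}"
      using inS assms(4-6) \<open>w \<notin> S\<close> unfolding S_def by auto
  qed (use f fw \<open>w \<in> V\<close> in auto)
  with \<open>hole_free E V\<close> show False by simp
qed

lemma hole_free_simplicial_vertex:
  assumes "finite V" "V \<noteq> {}" "hole_free E V" "sym E" "irrefl E"
  shows "\<exists>v\<in>V. clique_in E {u \<in> V. (u, v) \<in> E}"
  using assms(1-3)
proof (induction V rule: finite_psubset_induct)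
  case (psubset V)
  show ?case
  proof (cases "clique_in E V")
    case True
    then show ?thesis
      using psubset.prems unfolding clique_in_def by blast
  next
    case False
    define conn where "conn X \<longleftrightarrow> (\<forall>x\<in>X. \<forall>y\<in>X. (x, y) \<in> (E \<inter> X \<times> X)\<^sup>*)" for X
    define far where "far X = {w \<in> V. w \<notin> X \<and> (\<forall>x\<in>X. (x, w) \<notin> E)}" for X
    define F where "F = {X. X \<subseteq> V \<and> X \<noteq> {} \<and> conn X \<and> far X \<noteq> {}}"
    obtain a b where "a \<in> V" "b \<in> V" "a \<noteq> b" "(a, b) \<notin> E"
      using False unfolding clique_in_def by blast
    \<comment> \<open>The vertex \<open>b\<close> lies in \<open>far {a}\<close>.\<close>
    then have "{a} \<in> F"
      unfolding F_def conn_def far_def by auto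
    moreover have "finite F"
      by (rule finite_subset[of _ "Pow V"]) (use \<open>finite V\<close> in \<open>auto simp: F_def\<close>)
    ultimately obtain X where "X \<in> F" and max: "\<And>Y. Y \<in> F \<Longrightarrow> X \<subseteq> Y \<Longrightarrow> X = Y"
      using finite_has_maximal[of F] by blast
    then have X: "X \<subseteq> V" "X \<noteq> {}" "conn X" "far X \<noteq> {}"
      unfolding F_def by auto
    \<comment> \<open>Adding \<open>s\<close> to \<open>X\<close> keeps it connected. If
      \<open>s\<close> missed \<open>w\<close>, then \<open>w\<close> would still be far from the
      larger set, against the maximality of \<open>X\<close>.\<close>
    have joined: "(s, w) \<in> E" if s: "s \<in> V" "s \<notin> X" "x \<in> X" "(s, x) \<in> E" and w: "w \<in> far X" for s x w
    proof (rule ccontr)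
      assume "(s, w) \<notin> E"
      let ?Y = "insert s X"
      have xs: "(x, s) \<in> E"
        using s symD[OF \<open>sym E\<close>] by blast
      have mono: "(E \<inter> X \<times> X)\<^sup>* \<subseteq> (E \<inter> ?Y \<times> ?Y)\<^sup>*"
        by (rule rtrancl_mono) auto
      have to_s: "(y, s) \<in> (E \<inter> ?Y \<times> ?Y)\<^sup>*" and from_s: "(s, y) \<in> (E \<inter> ?Y \<times> ?Y)\<^sup>*"
        if "y \<in> X" for y
      proof -
        have "(y, x) \<in> (E \<inter> ?Y \<times> ?Y)\<^sup>*" "(x, y) \<in> (E \<inter> ?Y \<times> ?Y)\<^sup>*"
          using mono X(3) that s unfolding conn_def by auto
        then show "(y, s) \<in> (E \<inter> ?Y \<times> ?Y)\<^sup>*" "(s, y) \<in> (E \<inter> ?Y \<times> ?Y)\<^sup>*"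
          using s xs by (auto intro: rtrancl_into_rtrancl converse_rtrancl_into_rtrancl)
      qed
      have "conn ?Y"
        unfolding conn_def using to_s from_s mono X(3) unfolding conn_def by auto
      moreover have "w \<noteq> s"
        using w s xs unfolding far_def by auto
      then have "w \<in> far ?Y"
        using w \<open>(s, w) \<notin> E\<close> unfolding far_def by auto
      ultimately have "?Y \<in> F"
        using X(1) s(1) unfolding F_def by auto
      with max[of ?Y] s(2) show False by auto
    qed
    have "far X \<subset> V"
      using X(1,2) unfolding far_def by auto
    moreover have "hole_free E (far X)"
      using psubset.prems(2) by (rule hole_free_subset) (auto simp: far_def)
    ultimately obtain w where w: "w \<in> far X" "clique_in E {u \<in> far X. (u, w) \<in> E}"
      using psubset.IH X(4) by blast
    \<comment> \<open>A neighbour of \<open>w\<close> is not in \<open>X\<close>, because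
      \<open>w\<close> is far from \<open>X\<close>; it is itself far from \<open>X\<close> or has a
      neighbour there.\<close>
    have nbr: "u \<in> far X \<or> u \<notin> X \<and> (\<exists>x\<in>X. (u, x) \<in> E)" if "u \<in> V" "(u, w) \<in> E" for u
      using that w(1) symD[OF \<open>sym E\<close>] unfolding far_def by blast
    have "(u, u') \<in> E" if u: "u \<in> V" "(u, w) \<in> E" "u' \<in> V" "(u', w) \<in> E" "u \<noteq> u'" for u u'
    proof -
      \<comment> \<open>Two far vertices are settled by the choice of \<open>w\<close>, a far vertex
        and a neighbour of \<open>X\<close> by \<open>joined\<close>, two neighbours of
        \<open>X\<close> by the absence of holes through \<open>w\<close>.\<close>
      consider "u \<in> far X" "u' \<in> far X"
        | x where "u \<notin> X" "x \<in> X" "(u, x) \<in> E" "u' \<in> far X"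
        | x where "u' \<notin> X" "x \<in> X" "(u', x) \<in> E" "u \<in> far X"
        | x x' where "x \<in> X" "(u, x) \<in> E" "x' \<in> X" "(u', x') \<in> E"
        using nbr[OF u(1,2)] nbr[OF u(3,4)] by (elim disjE conjE bexE)
      then show ?thesis
      proof cases
        case 1
        then have "u \<in> {u \<in> far X. (u, w) \<in> E}" "u' \<in> {u \<in> far X. (u, w) \<in> E}"
          using u by auto
        with w(2) u(5) show ?thesis unfolding clique_in_def by blast
      next
        case 2
        then show ?thesis using joined[OF u(1)] by blast
      next
        case 3
        then show ?thesis using joined[OF u(3)] symD[OF \<open>sym E\<close>] by blast
      next
        case 4
        show ?thesis
        proof (rule hole_free_common_neighbours_adjacent
            [where w = w and x = x and x' = x', OF psubset.prems(2) assms(4,5) X(1)])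
          show "(x, y) \<in> (E \<inter> X \<times> X)\<^sup>*" if "x \<in> X" "y \<in> X" for x y
            using X(3) that unfolding conn_def by blast
        qed (use u 4 w(1) in \<open>auto simp: far_def\<close>)
      qed
    qed
    then show ?thesis
      using w(1) unfolding clique_in_def far_def by blast
  qed
qed

subsection \<open>Earlier neighbours\<close>

definition earlier :: "'a rel \<Rightarrow> 'a set \<Rightarrow> ('a \<Rightarrow> nat) \<Rightarrow> 'a \<Rightarrow> 'a set" where
  "earlier E V r v = {u \<in> V. r u < r v \<and> (u, v) \<in> E}"

text \<open>A simplicial vertex is ranked last, above an ordering of the rest. It precedes no other
  vertex, so the earlier neighbours of the others stay as they were.\<close>

lemma perfect_elimination_ordering:
  assumes "finite V" "hole_free E V" "sym E" "irrefl E"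
  shows "\<exists>r :: 'a \<Rightarrow> nat. inj_on r V \<and> (\<forall>v\<in>V. clique_in E (earlier E V r v))"
  using assms(1,2)
proof (induction V rule: finite_psubset_induct)
  case (psubset V)
  show ?case
  proof (cases "V = {}")
    case False
    then obtain v where v: "v \<in> V" "clique_in E {u \<in> V. (u, v) \<in> E}"
      using hole_free_simplicial_vertex[OF psubset.hyps _ psubset.prems assms(3,4)] by blast
    then obtain r where r: "inj_on r (V - {v})"
      "\<And>x. x \<in> V - {v} \<Longrightarrow> clique_in E (earlier E (V - {v}) r x)"
      using psubset.IH[of "V - {v}"] hole_free_subset[OF psubset.prems, of "V - {v}"] by blast
    define r' where "r' = r(v := Suc (Max (r ` V)))"
    have less: "r' x < r' v" if "x \<in> V" "x \<noteq> v" for x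
      using that psubset.hyps by (auto simp: r'_def less_Suc_eq_le)
    have "inj_on r' V"
    proof (rule inj_onI)
      fix x y assume "x \<in> V" "y \<in> V" "r' x = r' y"
      then show "x = y"
        using less[of x] less[of y] inj_onD[OF r(1), of x y]
        by (cases "x = v"; cases "y = v") (auto simp: r'_def)
    qed
    moreover have "clique_in E (earlier E V r' x)" if "x \<in> V" for x
    proof (cases "x = v")
      case True
      then show ?thesis using v unfolding clique_in_def earlier_def by auto
    next
      case False
      then have "earlier E V r' x = earlier E (V - {v}) r x"
        using less[of x] that unfolding earlier_def by (auto simp: r'_def)
      then show ?thesis using r(2) False that by auto
    qed
    ultimately show ?thesis by blast
  qed auto
qed

text \<open>Take the vertices of \<open>A\<close> by increasing rank. The one that follows
  \<open>i\<close> others has these among its at most \<open>t - 1\<close> earlier neighbours, so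
  together with itself it adds at most \<open>t - i\<close> vertices. Summing \<open>t - i\<close>
  over \<open>i < card A\<close> gives the difference of the two binomials, written as a sum to
  avoid truncated subtraction.\<close>

lemma card_two_steps_clique:
  fixes E :: "'a rel"
  assumes "finite A" "A \<subseteq> V" "finite V" "inj_on r V" "clique_in E A" "card A \<le> t"
    and bound: "\<And>x. x \<in> V \<Longrightarrow> card (earlier E V r x) < t"
  shows "card (A \<union> \<Union> (earlier E V r ` A)) + (t + 1 - card A choose 2) \<le> (t + 1 choose 2)"
  using assms(1,2,5,6)
proof (induction A rule: finite_ranking_induct[where f = r])
  case empty
  then show ?case by simp
next
  case (insert x A)
  show ?case
  proof (cases "x \<in> A")
    case True
    then show ?thesis
      using insert.IH insert.prems by (simp add: insert_absorb)
  next
    case False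
    let ?N = "earlier E V r"
    have fin: "finite (?N y)" for y
      using \<open>finite V\<close> unfolding earlier_def by auto
    have "r y < r x" if "y \<in> A" for y
    proof -
      have "r y \<noteq> r x"
        using False insert.prems(1) inj_onD[OF \<open>inj_on r V\<close>, of y x] that by auto
      then show ?thesis
        using insert.hyps(2)[OF that] by simp
    qed
    then have sub: "A \<subseteq> ?N x"
      using insert.prems(1,2) False unfolding earlier_def clique_in_def by auto
    have "insert x A \<union> \<Union> (?N ` insert x A) = (A \<union> \<Union> (?N ` A)) \<union> insert x (?N x - A)"
      by auto
    then have "card (insert x A \<union> \<Union> (?N ` insert x A))
        \<le> card (A \<union> \<Union> (?N ` A)) + card (insert x (?N x - A))"
      by (metis card_Un_le)
    also have "card (insert x (?N x - A)) \<le> Suc (card (?N x - A))"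
      using fin by (simp add: card_insert_if)
    also have "card (?N x - A) = card (?N x) - card A"
      using sub insert.hyps(1) by (rule card_Diff_subset[rotated])
    finally have step: "card (insert x A \<union> \<Union> (?N ` insert x A))
        \<le> card (A \<union> \<Union> (?N ` A)) + Suc (card (?N x) - card A)"
      by simp
    have card: "card (insert x A) = Suc (card A)"
      using insert.hyps False by simp
    have IH: "card (A \<union> \<Union> (?N ` A)) + (t + 1 - card A choose 2) \<le> (t + 1 choose 2)"
      using insert.IH insert.prems card unfolding clique_in_def by auto
    have "t + 1 - card A = Suc (t - card A)" "t + 1 - card (insert x A) = t - card A"
      using insert.prems(3) card by simp_all
    \<comment> \<open>Pascal's rule: the binomial on the left drops by exactly the
      \<open>t - card A\<close> vertices that \<open>x\<close> may add.\<close>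
    then have "(t + 1 - card A choose 2) = (t + 1 - card (insert x A) choose 2) + (t - card A)"
      by (simp add: numeral_2_eq_2)
    moreover have "Suc (card (?N x) - card A) \<le> t - card A"
      using bound[of x] insert.prems card by auto
    ultimately show ?thesis
      using step IH by linarith
  qed
qed

subsection \<open>Colouring\<close>

text \<open>Recursion along \<open>r\<close>: when \<open>v\<close> is coloured, the fewer than
  \<open>m\<close> vertices of \<open>B v\<close> already have colours and leave one of the
  \<open>m\<close> colours free.\<close>

lemma greedy_coloring:
  fixes r :: "'a \<Rightarrow> nat"
  assumes "\<And>v. finite (B v)" "\<And>v. card (B v) < m" "\<And>u v. u \<in> B v \<Longrightarrow> r u < r v"
  shows "\<exists>f :: 'a \<Rightarrow> nat. \<forall>v. f v < m \<and> f v \<notin> f ` B v"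
proof (rule dependent_wf_choice[of "Wellfounded.measure r" "\<lambda>f v c. c < m \<and> c \<notin> f ` B v"])
  show "(c < m \<and> c \<notin> f ` B v) = (c < m \<and> c \<notin> g ` B v)"
    if "\<And>u. (u, v) \<in> Wellfounded.measure r \<Longrightarrow> f u = g u" for f g v and c :: nat
    using that assms(3) by (metis image_cong in_measure)
  show "\<exists>c<m. c \<notin> f ` B v" for f :: "'a \<Rightarrow> nat" and v
  proof (rule ccontr)
    assume "\<not> (\<exists>c<m. c \<notin> f ` B v)"
    then have "{..<m} \<subseteq> f ` B v" by auto
    then have "m \<le> card (f ` B v)"
      using card_mono[of "f ` B v" "{..<m}"] assms(1) by simp
    also have "\<dots> \<le> card (B v)"
      using assms(1) by (rule card_image_le)
    finally show False using assms(2)[of v] by simp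
  qed
qed simp

text \<open>The edge \<open>xy\<close> is moved down to the representatives. Unless
  \<open>l = y\<close>, both \<open>x\<close> and \<open>l\<close> are earlier neighbours of
  \<open>y\<close>, so \<open>x\<close> and \<open>l\<close> are adjacent in any case. If
  \<open>x\<close> precedes \<open>l\<close>, then \<open>k\<close> is reached from \<open>l\<close>
  through \<open>x\<close>. Otherwise \<open>l\<close> precedes \<open>x\<close>, and the same
  argument at \<open>x\<close> makes \<open>k\<close> and \<open>l\<close> adjacent.\<close>

lemma earliest_vertices_of_adjacent_cliques:
  fixes r :: "'a \<Rightarrow> nat"
  assumes "sym E" "inj_on r V"
    and elim: "\<And>v. v \<in> V \<Longrightarrow> clique_in E (earlier E V r v)"
    and K: "K \<subseteq> V" "clique_in E K" "k \<in> K" "\<And>z. z \<in> K \<Longrightarrow> r k \<le> r z"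
    and L: "L \<subseteq> V" "clique_in E L" "l \<in> L" "\<And>z. z \<in> L \<Longrightarrow> r l \<le> r z"
    and "K \<inter> L = {}" and xy: "x \<in> K" "y \<in> L" "(x, y) \<in> E" "r x < r y"
  defines "B \<equiv> \<lambda>v. earlier E V r v \<union> \<Union> (earlier E V r ` earlier E V r v)"
  shows "k \<in> B l \<or> l \<in> B k"
proof -
  have earlierI: "u \<in> earlier E V r v" if "u \<in> V" "(u, v) \<in> E" "r u < r v" for u v
    using that unfolding earlier_def by blast
  have neq: "r u \<noteq> r v" if "u \<in> K" "v \<in> L" for u v
    using inj_onD[OF assms(2)] that K(1) L(1) \<open>K \<inter> L = {}\<close> by blast
  have descend: "u \<in> earlier E V r v" if "clique_in E M" "M \<subseteq> V" "u \<in> M" "v \<in> M" "r u \<le> r v" "u \<noteq> v"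
    for M u v
  proof -
    have "r u \<noteq> r v"
      using inj_onD[OF assms(2)] that by blast
    then show ?thesis
      using that by (intro earlierI) (auto simp: clique_in_def)
  qed
  have "(x, l) \<in> E"
  proof (cases "l = y")
    case False
    then have "l \<in> earlier E V r y" "x \<in> earlier E V r y"
      using descend[OF L(2,1)] L(3,4) xy K(1) by (auto intro: earlierI)
    moreover have "x \<noteq> l"
      using xy L(3) \<open>K \<inter> L = {}\<close> by auto
    ultimately show ?thesis
      using elim[of y] xy L(1) unfolding clique_in_def by blast
  qed (use xy in simp)
  show ?thesis
  proof (cases "r x < r l")
    case True
    then have "x \<in> earlier E V r l"
      using \<open>(x, l) \<in> E\<close> xy K(1) by (auto intro: earlierI)
    moreover have "k = x \<or> k \<in> earlier E V r x"
      using descend[OF K(2,1)] K(3,4) xy by blast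
    ultimately show ?thesis
      unfolding B_def by auto
  next
    case False
    then have l: "l \<in> earlier E V r x"
      using \<open>(x, l) \<in> E\<close> symD[OF assms(1)] neq[of x l] xy L(1,3) by (intro earlierI) auto
    have "(k, l) \<in> E"
    proof (cases "k = x")
      case False
      then have "k \<in> earlier E V r x"
        using descend[OF K(2,1)] K(3,4) xy by blast
      moreover have "k \<noteq> l"
        using K(3) L(3) \<open>K \<inter> L = {}\<close> by auto
      ultimately show ?thesis
        using elim[of x] l xy K(1) unfolding clique_in_def by blast
    qed (use \<open>(x, l) \<in> E\<close> in simp)
    then have "k \<in> earlier E V r l \<or> l \<in> earlier E V r k"
      using neq[OF K(3) L(3)] K(1,3) L(1,3) symD[OF assms(1)]
      by (metis earlierI linorder_neqE_nat subsetD)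
    then show ?thesis
      unfolding B_def by blast
  qed
qed

theorem theorem1p6:
  fixes G :: "'a pair_pre_digraph" and t :: nat
  assumes "t > 0"
    and "pair_graph G"
    and "chordal G"
    and "clique_number G \<le> t"
  shows "chromatic_number (AC G) \<le> (t + 1) choose 2"
proof -
  interpret pair_graph G by fact
  let ?E = "parcs G" and ?V = "pverts G"
  have sym: "sym ?E"
    using pair_sym_arcs by (auto simp: symmetric_def)
  have irrefl: "irrefl ?E"
    unfolding irrefl_def by (auto dest: pair_no_loops)
  have cliques: "K \<in> cliques G \<longleftrightarrow> K \<noteq> {} \<and> K \<subseteq> ?V \<and> clique_in ?E K" for K
    unfolding cliques_def clique_in_def by blast
  have card_clique: "card K \<le> t" if "K \<in> cliques G" for K
  proof -
    have "card K \<le> clique_number G"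
      unfolding clique_number_def using that finite_cliques[OF assms(2)] by (intro Max_ge) auto
    with assms(4) show ?thesis by simp
  qed
  obtain r :: "'a \<Rightarrow> nat" where r: "inj_on r ?V"
    and elim: "\<And>v. v \<in> ?V \<Longrightarrow> clique_in ?E (earlier ?E ?V r v)"
    using perfect_elimination_ordering[OF pair_finite_verts chordal_hole_free[OF assms(2,3)] sym irrefl]
    by blast
  let ?N = "earlier ?E ?V r"
  have fin: "finite (?N v)" for v
    unfolding earlier_def by simp
  have N_sub: "?N v \<subseteq> ?V" for v
    unfolding earlier_def by auto
  have card_N: "card (?N v) < t" if "v \<in> ?V" for v
  proof -
    have "clique_in ?E (insert v (?N v))"
      using elim[OF that] sym unfolding clique_in_def earlier_def sym_def by blast
    then have "card (insert v (?N v)) \<le> t"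
      using that N_sub by (intro card_clique) (auto simp: cliques)
    moreover have "v \<notin> ?N v"
      unfolding earlier_def by simp
    ultimately show ?thesis
      using fin by simp
  qed
  define B where "B v = ?N v \<union> \<Union> (?N ` ?N v)" for v
  have card_B: "card (B v) < (t + 1 choose 2)" for v
  proof (cases "v \<in> ?V")
    case True
    have "card (B v) + (t + 1 - card (?N v) choose 2) \<le> (t + 1 choose 2)"
      unfolding B_def using fin N_sub pair_finite_verts r elim[OF True] less_imp_le[OF card_N[OF True]] card_N
      by (rule card_two_steps_clique)
    \<comment> \<open>Since \<open>?N v\<close> has fewer than \<open>t\<close> elements, the upper
      entry is at least 2, which makes the bound on \<open>card (B v)\<close> strict.\<close>
    moreover have "0 < (t + 1 - card (?N v) choose 2)"
      using card_N[OF True] by (simp add: zero_less_binomial_iff)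
    ultimately show ?thesis by linarith
  next
    \<comment> \<open>The greedy lemma colours the whole type, so vertices outside of
      \<open>G\<close> need the bound as well; it holds there because \<open>t > 0\<close>.\<close>
    case False
    then have "?N v = {}"
      unfolding earlier_def using in_arcsD2 by auto
    then show ?thesis
      using assms(1) by (simp add: B_def zero_less_binomial_iff)
  qed
  have "finite (B v)" "u \<in> B v \<Longrightarrow> r u < r v" for u v
    using fin unfolding B_def by (auto simp: earlier_def)
  then obtain f :: "'a \<Rightarrow> nat" where f: "\<And>v. f v < (t + 1 choose 2)" "\<And>v. f v \<notin> f ` B v"
    using greedy_coloring[of B "t + 1 choose 2" r] card_B by blast
  \<comment> \<open>The representative of \<open>K\<close>, its vertex of least rank.\<close>
  define top where "top K = arg_min_on r K" for K
  have top: "top K \<in> K" "z \<in> K \<Longrightarrow> r (top K) \<le> r z" if "K \<in> cliques G" for K z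
  proof -
    have "finite K" "K \<noteq> {}"
      using that finite_subset[OF _ pair_finite_verts] by (auto simp: cliques)
    then show "top K \<in> K" "z \<in> K \<Longrightarrow> r (top K) \<le> r z"
      unfolding top_def by (auto intro: arg_min_if_finite(1) arg_min_least)
  qed
  have differ: "f (top K) \<noteq> f (top L)"
    if KL: "K \<in> cliques G" "L \<in> cliques G" "K \<inter> L = {}" "x \<in> K" "y \<in> L" "(x, y) \<in> ?E" "r x < r y"
    for K L x y
  proof -
    have "top K \<in> B (top L) \<or> top L \<in> B (top K)"
      unfolding B_def using KL top
      by (intro earliest_vertices_of_adjacent_cliques[OF sym r elim, of K "top K" L "top L" x y])
        (auto simp: cliques)
    then show ?thesis
      using f(2)[of "top K"] f(2)[of "top L"] by (metis imageI)
  qed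
  \<comment> \<open>Adjacency of cliques is symmetric, so the clique containing the earlier end of
    the edge can be taken as the first argument of \<open>differ\<close>.\<close>
  have "f (top K) \<noteq> f (top L)" if KL: "(K, L) \<in> parcs (AC G)" for K L
  proof -
    have C: "K \<in> cliques G" "L \<in> cliques G" "K \<inter> L = {}" "L \<inter> K = {}"
      using KL by (auto simp: AC_def adjacent_cliques_def)
    obtain x y where xy: "x \<in> K" "y \<in> L" "(x, y) \<in> ?E"
      using KL by (auto simp: AC_def adjacent_cliques_def)
    have "r x \<noteq> r y"
      using inj_onD[OF r] xy C in_arcsD1 in_arcsD2 by blast
    then consider "r x < r y" | "r y < r x" by linarith
    then show ?thesis
      using differ[of K L x y] differ[of L K y x] C xy symD[OF sym] by cases metis+
  qed
  then have "proper_coloring (AC G) (t + 1 choose 2) (\<lambda>K. f (top K))"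
    unfolding proper_coloring_def using f(1) by auto
  then show ?thesis
    unfolding chromatic_number_def by (intro Least_le exI)
qed

end
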